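(* $R_{15}\ge 83$, $R_{17}\ge107$, $R_{18}\ge122$, and $R_{19}\ge139$.
   Context: Gale--Berlekamp switching game: an $n\times n$ array of light bulbs, each on or off, is given in an initial configuration $\Theta_n$; there are $n$ row switches and $n$ column switches, each of which inverts the on/off state of every bulb in its row or column. Let $i(\Theta_n)$ be the smallest number of on-lights achievable from $\Theta_n$ by applying row and column switches, and $R_n:=\max\{i(\Theta_n):\Theta_n$ an initial configuration of $n\times n$ lights$\}$. Equivalently, $R_n=\frac12(n^2-G_n)$ where $G_n:=\min\{\max_{x,y\in\{-1,1\}^n}|\sum_{i,j=1}^n a_{ij}x_iy_j|:(a_{ij})\in\{-1,1\}^{n\times n}\}$. *)

theory Defs imports Main begin

text \<open>A configuration of the $n \times n$ array of lights is the set of (row, column) positions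
  that are switched on; rows and columns are numbered from $0$ to $n - 1$.\<close>

type_synonym lights = "(nat \<times> nat) set"

definition board :: "nat \<Rightarrow> lights" where
  "board n = {..<n} \<times> {..<n}"

definition row_switch :: "nat \<Rightarrow> nat \<Rightarrow> lights \<Rightarrow> lights" where
  "row_switch n i \<Theta> = sym_diff \<Theta> ({i} \<times> {..<n})"

definition column_switch :: "nat \<Rightarrow> nat \<Rightarrow> lights \<Rightarrow> lights" where
  "column_switch n j \<Theta> = sym_diff \<Theta> ({..<n} \<times> {j})"

inductive_set reachable :: "nat \<Rightarrow> lights \<Rightarrow> lights set" for n :: nat and \<Theta> :: lights where
  initial: "\<Theta> \<in> reachable n \<Theta>"
| row: "\<Phi> \<in> reachable n \<Theta> \<Longrightarrow> i < n \<Longrightarrow> row_switch n i \<Phi> \<in> reachable n \<Theta>"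
| column: "\<Phi> \<in> reachable n \<Theta> \<Longrightarrow> j < n \<Longrightarrow> column_switch n j \<Phi> \<in> reachable n \<Theta>"

definition min_on :: "nat \<Rightarrow> lights \<Rightarrow> nat" where
  "min_on n \<Theta> = Min (card ` reachable n \<Theta>)"

definition R :: "nat \<Rightarrow> nat" where
  "R n = Max (min_on n ` Pow (board n))"

text \<open>Both extrema range over finite nonempty sets, so they are attained.\<close>

lemma reachable_subset_board:
  assumes "\<Theta> \<subseteq> board n" and "\<Phi> \<in> reachable n \<Theta>"
  shows "\<Phi> \<subseteq> board n"
  using assms(2,1)
  by (induction rule: reachable.induct)
    (auto simp: board_def row_switch_def column_switch_def)

lemma finite_board: "finite (board n)"
  by (simp add: board_def)

lemma finite_reachable:
  assumes "\<Theta> \<subseteq> board n"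
  shows "finite (reachable n \<Theta>)"
  using reachable_subset_board[OF assms] finite_board[of n]
  by (meson PowI finite_Pow_iff finite_subset subsetI)

lemma min_on_attained:
  assumes "\<Theta> \<subseteq> board n"
  shows "\<exists>\<Phi>\<in>reachable n \<Theta>. card \<Phi> = min_on n \<Theta>"
proof -
  have "min_on n \<Theta> \<in> card ` reachable n \<Theta>"
    unfolding min_on_def using finite_reachable[OF assms] reachable.initial
    by (intro Min_in) auto
  then show ?thesis by auto
qed

lemma R_attained: "\<exists>\<Theta>\<subseteq>board n. min_on n \<Theta> = R n"
proof -
  have "R n \<in> min_on n ` Pow (board n)"
    unfolding R_def using finite_board by (intro Max_in) auto
  then show ?thesis by auto
qed

end

theory Submission imports Defs "HOL-Analysis.Convex" begin

text \<open>
  Switching turns a sign matrix \<open>A\<close> into \<open>(x\<^sub>i y\<^sub>j a\<^sub>i\<^sub>j)\<close>, and the number of lights on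
  is \<open>(n\<^sup>2 - x\<^sup>T A y) / 2\<close>. If \<open>A\<close> is an \<open>n \<times> n\<close> corner of an \<open>N \<times> N\<close> Hadamard matrix, its
  spectral norm is at most \<open>\<surd>N\<close>, so \<open>x\<^sup>T A y \<le> n \<surd>N\<close> and \<open>2 R\<^sub>n \<ge> n\<^sup>2 - n \<surd>N\<close>. The Sylvester
  matrix of order 16 settles \<open>n = 15\<close>; the Paley matrix of order 20 settles 17, 18 and 19.
\<close>

definition hadamard :: "nat \<Rightarrow> (nat \<Rightarrow> nat \<Rightarrow> int) \<Rightarrow> bool" where
  "hadamard N H \<longleftrightarrow> (\<forall>i<N. \<forall>j<N. H i j \<in> {1, -1}) \<and>
    (\<forall>j<N. \<forall>k<N. (\<Sum>i<N. H i j * H i k) = (if j = k then int N else 0))"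

text \<open>Cauchy-Schwarz separates \<open>x\<close> from the vector \<open>r\<close>, the corner
  applied to \<open>y\<close>, and column orthogonality bounds the norm of \<open>r\<close>.\<close>

lemma hadamard_bilinear_bound:
  assumes H: "hadamard N H" and "n \<le> N"
    and x: "\<And>i. i < n \<Longrightarrow> x i \<in> {1, -1}" and y: "\<And>j. j < n \<Longrightarrow> y j \<in> {1, -1}"
  shows "(\<Sum>i<n. \<Sum>j<n. x i * y j * H i j)\<^sup>2 \<le> (int n)\<^sup>2 * int N"
proof -
  define r where "r i = (\<Sum>j<n. y j * H i j)" for i
  have sq_x: "(\<Sum>i<n. (x i)\<^sup>2) = int n"
    using x by (subst sum.cong[OF refl, where h = "\<lambda>_. 1"]) fastforce+
  have sq_y: "(\<Sum>j<n. (y j)\<^sup>2) = int n"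
    using y by (subst sum.cong[OF refl, where h = "\<lambda>_. 1"]) fastforce+
  \<comment> \<open>Columns are orthogonal only over all \<open>N\<close> rows, so the missing rows
    are added at the cost of nonnegative squares. The column range stays below \<open>n\<close>, as
    if \<open>y\<close> were padded with zeros.\<close>
  have "(\<Sum>i<n. (r i)\<^sup>2) \<le> (\<Sum>i<N. (r i)\<^sup>2)"
    using \<open>n \<le> N\<close> by (intro sum_mono2) auto
  also have "\<dots> = (\<Sum>i<N. \<Sum>j<n. \<Sum>k<n. y j * y k * (H i j * H i k))"
    by (simp add: r_def power2_eq_square sum_product mult_ac)
  also have "\<dots> = (\<Sum>j<n. \<Sum>i<N. \<Sum>k<n. y j * y k * (H i j * H i k))"
    by (rule sum.swap)
  also have "\<dots> = (\<Sum>j<n. \<Sum>k<n. y j * y k * (\<Sum>i<N. H i j * H i k))"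
    unfolding sum_distrib_left by (intro sum.cong refl sum.swap)
  also have "\<dots> = (\<Sum>j<n. \<Sum>k<n. if j = k then (y j)\<^sup>2 * int N else 0)"
    using H \<open>n \<le> N\<close> by (intro sum.cong refl) (auto simp: hadamard_def power2_eq_square)
  also have "\<dots> = int n * int N"
    using sq_y by (simp flip: sum_distrib_right)
  finally have sq_r: "(\<Sum>i<n. (r i)\<^sup>2) \<le> int n * int N" .
  have "(\<Sum>i<n. \<Sum>j<n. x i * y j * H i j) = (\<Sum>i<n. x i * r i)"
    by (simp add: r_def sum_distrib_left mult_ac)
  moreover have "real_of_int ((\<Sum>i<n. x i * r i)\<^sup>2) \<le>
      real_of_int ((\<Sum>i<n. (x i)\<^sup>2) * (\<Sum>i<n. (r i)\<^sup>2))"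
    using Cauchy_Schwarz_ineq_sum[of "\<lambda>i. real_of_int (x i)" "\<lambda>i. real_of_int (r i)"] by simp
  ultimately have "(\<Sum>i<n. \<Sum>j<n. x i * y j * H i j)\<^sup>2 \<le> int n * (\<Sum>i<n. (r i)\<^sup>2)"
    unfolding of_int_le_iff sq_x by simp
  also have "\<dots> \<le> int n * (int n * int N)"
    using sq_r by (intro mult_left_mono) auto
  finally show ?thesis by (simp add: power2_eq_square mult_ac)
qed

definition light_sign :: "lights \<Rightarrow> nat \<Rightarrow> nat \<Rightarrow> int" where
  "light_sign \<Phi> i j = (if (i, j) \<in> \<Phi> then -1 else 1)"

lemma sum_light_sign:
  assumes "\<Phi> \<subseteq> board n"
  shows "(\<Sum>i<n. \<Sum>j<n. light_sign \<Phi> i j) = (int n)\<^sup>2 - 2 * int (card \<Phi>)"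
proof -
  have "(\<Sum>i<n. \<Sum>j<n. light_sign \<Phi> i j) = (\<Sum>p\<in>board n. 1 - 2 * of_bool (p \<in> \<Phi>))"
    unfolding board_def sum.cartesian_product
    by (intro sum.cong) (auto simp: light_sign_def)
  also have "\<dots> = int (card (board n)) - 2 * int (card (board n \<inter> \<Phi>))"
    using finite_board[of n]
    by (simp add: sum_subtractf sum_of_bool_eq flip: sum_distrib_left)
  finally show ?thesis
    using assms by (simp add: board_def power2_eq_square Int_absorb1)
qed

lemma light_sign_reachable:
  assumes "\<Phi> \<in> reachable n \<Theta>"
  shows "\<exists>x y. (\<forall>i. x i \<in> {1, -1}) \<and> (\<forall>j. y j \<in> {1, -1}) \<and>
    (\<forall>i<n. \<forall>j<n. light_sign \<Phi> i j = x i * y j * light_sign \<Theta> i j)"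
  using assms
proof induction
  case initial
  show ?case by (intro exI[of _ "\<lambda>_. 1"]) simp
next
  case (row \<Phi> k)
  then obtain x y where xy: "\<forall>i. x i \<in> {1, -1}" "\<forall>j. y j \<in> {1, -1}"
    "\<forall>i<n. \<forall>j<n. light_sign \<Phi> i j = x i * y j * light_sign \<Theta> i j" by blast
  \<comment> \<open>The factor depends on the row alone, so it is absorbed by negating
    \<open>x k\<close>; a column switch negates \<open>y k\<close> likewise.\<close>
  have "light_sign (row_switch n k \<Phi>) i j = (if i = k then -1 else 1) * light_sign \<Phi> i j"
    if "j < n" for i j
    using that by (auto simp: light_sign_def row_switch_def)
  with xy show ?case
    by (intro exI[of _ "x(k := - x k)"] exI[of _ y]) auto
next
  case (column \<Phi> k)
  then obtain x y where xy: "\<forall>i. x i \<in> {1, -1}" "\<forall>j. y j \<in> {1, -1}"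
    "\<forall>i<n. \<forall>j<n. light_sign \<Phi> i j = x i * y j * light_sign \<Theta> i j" by blast
  have "light_sign (column_switch n k \<Phi>) i j = (if j = k then -1 else 1) * light_sign \<Phi> i j"
    if "i < n" for i j
    using that by (auto simp: light_sign_def column_switch_def)
  with xy show ?case
    by (intro exI[of _ x] exI[of _ "y(k := - y k)"]) auto
qed

lemma R_ge_hadamard:
  assumes H: "hadamard N H" and "n \<le> N"
  shows "(real n)\<^sup>2 - real n * sqrt (real N) \<le> 2 * real (R n)"
proof -
  define \<Theta> where "\<Theta> = {(i, j) \<in> board n. H i j = -1}"
  have \<Theta>: "\<Theta> \<subseteq> board n" by (auto simp: \<Theta>_def)
  have sign: "light_sign \<Theta> i j = H i j" if "i < n" "j < n" for i j
  proof -
    have "H i j \<in> {1, -1}"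
      using that H \<open>n \<le> N\<close> by (auto simp: hadamard_def)
    then show ?thesis
      using that by (auto simp: light_sign_def \<Theta>_def board_def)
  qed
  \<comment> \<open>A best reachable configuration: a bound on its signed sum \<open>S\<close>
    bounds \<open>min_on\<close> for this start from below, hence \<open>R n\<close>.\<close>
  obtain \<Phi> where \<Phi>: "\<Phi> \<in> reachable n \<Theta>" "card \<Phi> = min_on n \<Theta>"
    using min_on_attained[OF \<Theta>] by blast
  define S where "S = (int n)\<^sup>2 - 2 * int (card \<Phi>)"
  obtain x y where xy: "\<forall>i. x i \<in> {1, -1}" "\<forall>j. y j \<in> {1, -1}"
    "\<forall>i<n. \<forall>j<n. light_sign \<Phi> i j = x i * y j * light_sign \<Theta> i j"
    using light_sign_reachable[OF \<Phi>(1)] by blast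
  have "S = (\<Sum>i<n. \<Sum>j<n. light_sign \<Phi> i j)"
    unfolding S_def by (rule sum_light_sign[OF reachable_subset_board[OF \<Theta> \<Phi>(1)], symmetric])
  also have "\<dots> = (\<Sum>i<n. \<Sum>j<n. x i * y j * H i j)"
    using xy(3) sign by simp
  finally have "S\<^sup>2 \<le> (int n)\<^sup>2 * int N"
    using hadamard_bilinear_bound[OF H \<open>n \<le> N\<close>, of x y] xy by simp
  then have "real_of_int (S\<^sup>2) \<le> real_of_int ((int n)\<^sup>2 * int N)"
    by (simp only: of_int_le_iff)
  then have "(real_of_int S)\<^sup>2 \<le> (real n)\<^sup>2 * real N" by simp
  then have "real_of_int S \<le> real n * sqrt (real N)"
    using real_le_rsqrt by (fastforce simp: real_sqrt_mult)
  moreover have "card \<Phi> \<le> R n"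
    unfolding \<Phi>(2) R_def using \<Theta> finite_board[of n] by (intro Max_ge) auto
  ultimately show ?thesis by (simp add: S_def)
qed

text \<open>The sign is (-1) to the number of binary digits, among the lowest \<open>k\<close>, that
  are 1 in both \<open>i\<close> and \<open>j\<close>. Peeling off the last digit is the Kronecker
  product with the 2 by 2 matrix.\<close>

primrec sylvester :: "nat \<Rightarrow> nat \<Rightarrow> nat \<Rightarrow> int" where
  "sylvester 0 i j = 1"
| "sylvester (Suc k) i j =
    (if odd i \<and> odd j then -1 else 1) * sylvester k (i div 2) (j div 2)"

lemma sum_lessThan_double:
  "(\<Sum>i<2 * m. f i) = (\<Sum>i<m. f (2 * i) + f (Suc (2 * i)))" for f :: "nat \<Rightarrow> 'a::comm_monoid_add"
  by (induction m) (simp_all add: add.assoc)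

lemma hadamard_sylvester: "hadamard (2 ^ k) (sylvester k)"
proof -
  have "sylvester k i j \<in> {1, -1}" for i j
    by (induction k arbitrary: i j) auto
  moreover have "(\<Sum>i<2 ^ k. sylvester k i j * sylvester k i l) = (if j = l then 2 ^ k else 0)"
    if "j < 2 ^ k" "l < 2 ^ k" for j l
    using that
  proof (induction k arbitrary: j l)
    case (Suc k)
    have parity_eq: "j = l \<longleftrightarrow> (odd j \<longleftrightarrow> odd l) \<and> j div 2 = l div 2"
      by (auto elim!: oddE evenE)
    \<comment> \<open>Rows \<open>2 * i\<close> and \<open>Suc (2 * i)\<close> are paired. The
      prefactor is 2 if \<open>j\<close> and \<open>l\<close> have equal parity and 0
      otherwise.\<close>
    have "(\<Sum>i<2 ^ Suc k. sylvester (Suc k) i j * sylvester (Suc k) i l) =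
      (1 + (if odd j then -1 else 1) * (if odd l then -1 else 1)) *
      (\<Sum>i<2 ^ k. sylvester k i (j div 2) * sylvester k i (l div 2))"
      unfolding power_Suc sum_lessThan_double sum_distrib_left
      by (intro sum.cong refl) (auto simp: algebra_simps)
    also have "(\<Sum>i<2 ^ k. sylvester k i (j div 2) * sylvester k i (l div 2)) =
      (if j div 2 = l div 2 then 2 ^ k else 0)"
      using Suc.prems by (intro Suc.IH) auto
    finally show ?case
      using parity_eq by auto
  qed simp
  ultimately show ?thesis by (simp add: hadamard_def)
qed

text \<open>The set below consists of the nonzero squares modulo 19.\<close>

definition paley20 :: "nat \<Rightarrow> nat \<Rightarrow> int" where
  "paley20 i j = (if i = 19 \<or> j = 19 \<or> (i + 19 - j) mod 19 \<in> {1, 4, 5, 6, 7, 9, 11, 16, 17}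
    then 1 else -1)"

text \<open>This is Paley's construction for the prime 19, which is 3 mod 4: index 19 is the border
  of ones and the diagonal within it is -1. Adding 19 before subtracting \<open>j\<close> avoids
  truncation in \<open>nat\<close>. Orthogonality is checked by evaluating all inner
  products.\<close>

lemma hadamard_paley20: "hadamard 20 paley20"
proof -
  have "\<forall>j\<in>set [0..<20]. \<forall>k\<in>set [0..<20].
    (\<Sum>i\<leftarrow>[0..<20]. paley20 i j * paley20 i k) = (if j = k then 20 else 0)"
    by code_simp
  then show ?thesis
    by (simp add: hadamard_def paley20_def interv_sum_list_conv_sum_set_nat atLeast0LessThan)
qed

theorem theorem5p1: "R 15 \<ge> 83 \<and> R 17 \<ge> 107 \<and> R 18 \<ge> 122 \<and> R 19 \<ge> 139"
proof -
  \<comment> \<open>The tightest case is \<open>n = 19\<close>: 2 \<open>R 19\<close> > 276 requires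
    a bound below 85/19 = 4.4736..., while \<open>sqrt 20\<close> = 4.4721.... Integrality of
    \<open>R n\<close> then rounds each estimate up.\<close>
  have "sqrt 20 < 4473 / 1000"
    by (rule real_less_lsqrt) (simp_all add: power2_eq_square)
  then show ?thesis
    using R_ge_hadamard[OF hadamard_sylvester[of 4], of 15]
      R_ge_hadamard[OF hadamard_paley20, of 17] R_ge_hadamard[OF hadamard_paley20, of 18]
      R_ge_hadamard[OF hadamard_paley20, of 19]
    by simp
qed

end
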